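(* Let $n,m$ be positive integers such that $n>m>1$. Let $k=n-m$ and suppose that $a=\frac{m(k+1)}{n}$ is not an integer. Then the bipartite graph $\widehat{G}_{n,m}^{\lceil a\rceil}=(U,V;E)$ with $U=\{u_i\mid i\in[n]\}$, $V=\{v_j\mid j\in[m]\}$ and $$E=\left\{(u_i,v_{(j+\alpha)\bmod m})\;\middle|\; i\in[n],\ \alpha\in[\lceil a\rceil],\ j=\left\lceil\frac{im}{n}\right\rceil\right\}$$ is $k$-critical-bipartite.
   Context: For a positive integer $o$, $[o]=\{0,1,\ldots,o-1\}$. All graphs are finite, simple and undirected. $G=(U,V;E)$ denotes a bipartite graph with color classes $U,V$ and edge set $E$. A bipartite graph $G=(U,V;E)$ with $k=|U|-|V|\ge 0$ is $k$-critical-bipartite if, after deleting any $k$ vertices from $U$, the remaining subgraph has a perfect matching. *)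

theory Defs
  imports Complex_Main
begin

text \<open>Edges are unordered pairs, i.e. two-element sets of vertices.\<close>

record 'v bip_graph =
  left_class :: "'v set"
  right_class :: "'v set"
  edges :: "'v set set"

definition bipartite_graph :: "'v bip_graph \<Rightarrow> bool" where
  "bipartite_graph G \<longleftrightarrow>
     finite (left_class G) \<and> finite (right_class G) \<and>
     left_class G \<inter> right_class G = {} \<and>
     edges G \<subseteq> {{u, v} | u v. u \<in> left_class G \<and> v \<in> right_class G}"

definition vertices :: "'v bip_graph \<Rightarrow> 'v set" where
  "vertices G = left_class G \<union> right_class G"

definition delete_vertices :: "'v bip_graph \<Rightarrow> 'v set \<Rightarrow> 'v bip_graph" where
  "delete_vertices G S =
     \<lparr>left_class = left_class G - S,
      right_class = right_class G - S,
      edges = {e \<in> edges G. e \<inter> S = {}}\<rparr>"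

definition perfect_matching :: "'v bip_graph \<Rightarrow> 'v set set \<Rightarrow> bool" where
  "perfect_matching G M \<longleftrightarrow>
     M \<subseteq> edges G \<and>
     (\<forall>e\<in>M. \<forall>f\<in>M. e \<noteq> f \<longrightarrow> e \<inter> f = {}) \<and>
     (\<forall>x\<in>vertices G. \<exists>e\<in>M. x \<in> e)"

definition critical_bipartite :: "nat \<Rightarrow> 'v bip_graph \<Rightarrow> bool" where
  "critical_bipartite k G \<longleftrightarrow>
     bipartite_graph G \<and>
     card (left_class G) = card (right_class G) + k \<and>
     (\<forall>S \<subseteq> left_class G. card S = k \<longrightarrow> (\<exists>M. perfect_matching (delete_vertices G S) M))"

text \<open>The vertices \<open>u\<^sub>i\<close> and \<open>v\<^sub>j\<close> are \<open>Inl i\<close> and \<open>Inr j\<close>, which makes the two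
  colour classes disjoint. The ceiling below is of a nonnegative number, so \<^const>\<open>nat\<close> loses
  nothing.\<close>

definition G_hat :: "nat \<Rightarrow> nat \<Rightarrow> nat \<Rightarrow> (nat + nat) bip_graph" where
  "G_hat n m b =
     \<lparr>left_class = {Inl i | i. i < n},
      right_class = {Inr j | j. j < m},
      edges = {{Inl i, Inr ((j + \<alpha>) mod m)} | i j \<alpha>.
                 i < n \<and> \<alpha> < b \<and> j = nat \<lceil>real i * real m / real n\<rceil>}\<rparr>"

end

theory Submission
  imports Defs "HOL-Library.Infinite_Set"
begin

text \<open>List the \<open>m\<close> remaining vertices of \<open>U\<close> as \<open>u\<^bsub>h 0\<^esub>, \<dots>, u\<^bsub>h (m - 1)\<^esub>\<close> with \<open>h\<close> increasing, and
  put \<open>J i = \<lceil>i m / n\<rceil>\<close>. For a suitable shift \<open>s\<close>, matching \<open>u\<^bsub>h r\<^esub>\<close> with \<open>v\<^bsub>(r + s) mod m\<^esub>\<close> works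
  for all \<open>r < m\<close> simultaneously. Indeed \<open>s\<close> is suitable if \<open>0 \<le> r + s - J (h r) < \<lceil>a\<rceil>\<close> for all
  \<open>r\<close>, so it suffices that any two values of \<open>J (h r) - r\<close> differ by less than \<open>\<lceil>a\<rceil>\<close>. This
  follows from \<open>d \<le> h (r + d) - h r \<le> k + d\<close>; the extreme cases are \<open>d = m - 1\<close> in the lower
  bound and \<open>d = 1\<close> in the upper one, both of which give a difference of at most \<open>\<lceil>a - 1\<rceil>\<close>.\<close>

text \<open>Clears denominators once and for all: these bounds are all that is used about the
  ceilings in \<open>J\<close> and \<open>c\<close>, so the later estimates are pure integer
  arithmetic.\<close>

lemma nat_ceiling_divide_bounds:
  fixes p n :: nat
  assumes "n > 0"
  shows "p \<le> n * nat \<lceil>real p / real n\<rceil>" and "n * nat \<lceil>real p / real n\<rceil> < p + n"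
proof -
  define c where "c = nat \<lceil>real p / real n\<rceil>"
  have "real p / real n \<le> real c" "real c < real p / real n + 1"
    using ceiling_correct[of "real p / real n"] by (simp_all add: c_def)
  with assms have "real p \<le> real (n * c)" "real (n * c) < real (p + n)"
    by (simp_all add: field_simps)
  then show "p \<le> n * nat \<lceil>real p / real n\<rceil>" "n * nat \<lceil>real p / real n\<rceil> < p + n"
    unfolding of_nat_le_iff of_nat_less_iff c_def .
qed

lemma strict_mono_on_nat_gap:
  fixes h :: "nat \<Rightarrow> nat"
  assumes "strict_mono_on {..<m} h" and "r + d < m"
  shows "h r + d \<le> h (r + d)"
  using assms(2)
proof (induction d)
  case (Suc d)
  have "h (r + d) < h (r + Suc d)"
    using Suc.prems by (intro strict_mono_onD[OF assms(1)]) auto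
  with Suc show ?case by simp
qed simp

text \<open>Once the values \<open>J (h r) - r\<close> are known to lie within \<open>c\<close> of
  each other pairwise, their maximum is a valid shift. The \<open>s\<close> obtained here is that
  maximum raised by \<open>m\<close>.\<close>

lemma common_shift:
  fixes h J :: "nat \<Rightarrow> nat"
  assumes "m > 0" and n: "n = m + k"
    and h: "strict_mono_on {..<m} h" and hn: "\<And>r. r < m \<Longrightarrow> h r < n"
    and J: "\<And>i. i * m \<le> n * J i" "\<And>i. n * J i < i * m + n"
    and c: "m * (k + 1) \<le> n * c"
  obtains s where "\<And>r. r < m \<Longrightarrow> J (h r) + m \<le> r + s \<and> r + s < J (h r) + m + c"
proof -
  \<comment> \<open>\<open>J (h r) - r\<close>, raised by \<open>m\<close> to stay clear of truncated subtraction; this is harmless modulo \<open>m\<close>\<close>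
  define g where "g r = J (h r) + (m - r)" for r
  have close: "g r < g q + c" if "r < m" "q < m" for r q
  proof -
    have "int n * (int (J (h r)) - int r - int (J (h q)) + int q - int c) < 0"
    proof -
      \<comment> \<open>Bounding \<open>J (h r)\<close> above and \<open>J (h q)\<close> and
        \<open>c\<close> below leaves only \<open>h r - h q\<close> to be estimated.\<close>
      have *: "int n * (int (J (h r)) - int r - int (J (h q)) + int q - int c)
          < int (h r) * int m + int n - int (h q) * int m
              - int n * (int r - int q) - int m * (int k + 1)"
      proof -
        have "int (n * J (h r)) < int (h r * m + n)" "int (h q * m) \<le> int (n * J (h q))"
          "int (m * (k + 1)) \<le> int (n * c)"
          using J(1)[of "h q"] J(2)[of "h r"] c by linarith+
        then show ?thesis by (simp add: algebra_simps)
      qed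
      consider "r = q" | d where "r = q + d" "d \<ge> 1" | d where "q = r + d" "d \<ge> 1"
      proof (cases q r rule: linorder_cases)
        case less
        then show ?thesis using that(2)[of "r - q"] by simp
      next
        case equal
        then show ?thesis using that(1) by simp
      next
        case greater
        then show ?thesis using that(3)[of "q - r"] by simp
      qed
      then show ?thesis
      proof cases
        case 1
        have "c > 0" using c \<open>m > 0\<close> by (cases c) auto
        with 1 n \<open>m > 0\<close> show ?thesis by simp
      next
        case (2 d)
        \<comment> \<open>Counting gaps from both ends of \<open>[n]\<close> gives
          \<open>q \<le> h q\<close> and \<open>h r \<le> k + r\<close>.\<close>
        have "h 0 + q \<le> h q" "h r + (m - 1 - r) \<le> h (m - 1)"
          using that strict_mono_on_nat_gap[OF h, of 0 q]
            strict_mono_on_nat_gap[OF h, of r "m - 1 - r"] by simp_all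
        moreover have "h (m - 1) < n" using \<open>m > 0\<close> hn by simp
        ultimately have "int (h r) - int (h q) \<le> int k + int d"
          using 2 n that by linarith
        then have "(int (h r) - int (h q)) * int m \<le> (int k + int d) * int m"
          by (rule mult_right_mono) simp
        \<comment> \<open>With \<open>n = m + k\<close>, the right side of \<open>*\<close> is at
          most \<open>- (d - 1) * k\<close>.\<close>
        moreover have "0 \<le> (int d - 1) * int k" using 2 by simp
        ultimately show ?thesis using * 2 n by (simp add: algebra_simps)
      next
        case (3 d)
        have "h r + d \<le> h q" using strict_mono_on_nat_gap[OF h] 3 that by simp
        then have "int d * int m \<le> (int (h q) - int (h r)) * int m"
          by (intro mult_right_mono) linarith+
        \<comment> \<open>Here the right side of \<open>*\<close> is at most
          \<open>- (m - 1 - d) * k\<close>, and \<open>d \<le> m - 1\<close> because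
          \<open>q < m\<close>.\<close>
        moreover have "0 \<le> (int m - 1 - int d) * int k" using 3 that by simp
        ultimately show ?thesis using * 3 n by (simp add: algebra_simps)
      qed
    qed
    then have "int (J (h r)) - int r - int (J (h q)) + int q - int c < 0"
      by (simp add: mult_less_0_iff)
    with that show ?thesis unfolding g_def by linarith
  qed
  define s where "s = Max (g ` {..<m})"
  have ne: "g ` {..<m} \<noteq> {}" using \<open>m > 0\<close> by auto
  have "s \<in> g ` {..<m}" unfolding s_def using ne by (intro Max_in) auto
  then obtain r0 where r0: "r0 < m" "s = g r0" by auto
  have "J (h r) + m \<le> r + s \<and> r + s < J (h r) + m + c" if "r < m" for r
  proof -
    have "g r \<le> s" unfolding s_def using that by simp
    moreover have "s < g r + c" using close r0 that by simp
    ultimately show ?thesis using that unfolding g_def by linarith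
  qed
  then show thesis by (rule that)
qed

lemma inj_on_add_mod:
  fixes m s :: nat
  shows "inj_on (\<lambda>r. (r + s) mod m) {..<m}"
proof (rule linorder_inj_onI)
  fix x y :: nat
  assume "x < y" "x \<in> {..<m}" "y \<in> {..<m}"
  then show "(x + s) mod m \<noteq> (y + s) mod m"
    using mod_eq_dvd_iff_nat[of "x + s" "y + s" m] by (auto dest!: dvd_imp_le)
qed auto

theorem corollary3p7:
  fixes n m k :: nat and a :: real
  assumes "n > m" and "m > 1"
    and "k = n - m"
    and "a = real m * (real k + 1) / real n"
    and "a \<notin> \<int>"
  shows "critical_bipartite k (G_hat n m (nat \<lceil>a\<rceil>))"
proof -
  define c where "c = nat \<lceil>a\<rceil>"
  define J where "J i = nat \<lceil>real i * real m / real n\<rceil>" for i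
  let ?G = "G_hat n m c"
  have n: "n = m + k" and "n > 0" and "m > 0" using assms by auto
  have J: "i * m \<le> n * J i" "n * J i < i * m + n" for i
    using nat_ceiling_divide_bounds[OF \<open>n > 0\<close>, of "i * m"] by (simp_all add: J_def)
  have c: "m * (k + 1) \<le> n * c"
    using nat_ceiling_divide_bounds(1)[OF \<open>n > 0\<close>, of "m * (k + 1)"]
    by (simp add: c_def assms(4) algebra_simps)
  have left: "left_class ?G = Inl ` {..<n}" and right: "right_class ?G = Inr ` {..<m}"
    by (auto simp: G_hat_def)
  have edge: "{Inl i, Inr ((J i + \<alpha>) mod m)} \<in> edges ?G" if "i < n" "\<alpha> < c" for i \<alpha>
    using that by (auto simp: G_hat_def J_def)
  have "bipartite_graph ?G"
  proof -
    have "edges ?G \<subseteq> {{u, v} | u v. u \<in> left_class ?G \<and> v \<in> right_class ?G}"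
    proof
      fix e assume "e \<in> edges ?G"
      then obtain i l where e: "e = {Inl i, Inr (l mod m)}" "i < n"
        by (auto simp: G_hat_def)
      have "l mod m < m" using \<open>m > 0\<close> by simp
      with e show "e \<in> {{u, v} | u v. u \<in> left_class ?G \<and> v \<in> right_class ?G}"
        unfolding left right by blast
    qed
    then show ?thesis by (auto simp: bipartite_graph_def left right)
  qed
  moreover have "card (left_class ?G) = card (right_class ?G) + k"
    unfolding left right by (simp add: card_image n)
  moreover have "\<exists>M. perfect_matching (delete_vertices ?G S) M"
    if S: "S \<subseteq> left_class ?G" "card S = k" for S
  proof -
    define W where "W = {i. i < n \<and> Inl i \<notin> S}"
    have "Inl ` W = Inl ` {..<n} - S" by (auto simp: W_def)
    then have "card (Inl ` W :: (nat + nat) set) = m"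
      using S n unfolding left by (simp add: card_Diff_subset finite_subset card_image)
    then have "card W = m" by (simp add: card_image)
    moreover have "finite W" by (simp add: W_def)
    ultimately obtain h where h: "bij_betw h {..<m} W" "strict_mono_on {..<m} h"
      using ex_bij_betw_strict_mono_card[of W] by metis
    have hW: "h r < n" "Inl (h r) \<notin> S" if "r < m" for r
      using that h(1) by (auto simp: W_def bij_betw_def)
    obtain s where s: "\<And>r. r < m \<Longrightarrow> J (h r) + m \<le> r + s \<and> r + s < J (h r) + m + c"
      using common_shift[OF \<open>m > 0\<close> n h(2) hW(1) J c] by metis
    define p where "p r = (r + s) mod m" for r
    define M where "M = (\<lambda>r. {Inl (h r), Inr (p r)}) ` {..<m}"
    have p_inj: "inj_on p {..<m}" unfolding p_def by (rule inj_on_add_mod)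
    \<comment> \<open>So \<open>p\<close> permutes the indices of \<open>V\<close>, and the matching
      reaches all of \<open>V\<close>.\<close>
    have p_img: "p ` {..<m} = {..<m}"
      using \<open>m > 0\<close> by (intro endo_inj_surj p_inj) (auto simp: p_def)
    have "M \<subseteq> edges (delete_vertices ?G S)"
    proof
      fix e assume "e \<in> M"
      then obtain r where r: "r < m" "e = {Inl (h r), Inr (p r)}" by (auto simp: M_def)
      \<comment> \<open>The bracket is the offset \<open>\<alpha>\<close> of the edge at
        \<open>h r\<close>; the bounds on \<open>s\<close> make it a natural number below
        \<open>c\<close>, and the last \<open>m\<close> vanishes modulo \<open>m\<close>.\<close>
      have "r + s = J (h r) + (r + s - J (h r) - m) + m"
        using s[OF r(1)] by linarith
      then have "p r = (J (h r) + (r + s - J (h r) - m)) mod m"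
        unfolding p_def by (metis mod_add_self2)
      moreover have "r + s - J (h r) - m < c" using s[OF r(1)] by linarith
      ultimately have "e \<in> edges ?G" using edge hW r by metis
      moreover have "Inr (p r) \<notin> S" using S(1) unfolding left by auto
      ultimately show "e \<in> edges (delete_vertices ?G S)"
        using hW(2)[OF r(1)] r(2) by (simp add: delete_vertices_def)
    qed
    moreover have "\<forall>e\<in>M. \<forall>f\<in>M. e \<noteq> f \<longrightarrow> e \<inter> f = {}"
    proof (intro ballI impI)
      fix e f assume "e \<in> M" "f \<in> M" "e \<noteq> f"
      then obtain r q where rq: "r < m" "q < m" "r \<noteq> q"
        and ef: "e = {Inl (h r), Inr (p r)}" "f = {Inl (h q), Inr (p q)}"
        unfolding M_def by blast
      have "h r \<noteq> h q" "p r \<noteq> p q"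
        using rq inj_onD[OF p_inj] inj_onD[OF bij_betw_imp_inj_on[OF h(1)]] by blast+
      then show "e \<inter> f = {}" by (simp add: ef)
    qed
    moreover have "\<forall>x \<in> vertices (delete_vertices ?G S). \<exists>e\<in>M. x \<in> e"
    proof
      fix x assume x: "x \<in> vertices (delete_vertices ?G S)"
      have "x \<in> Inl ` W \<or> x \<in> Inr ` {..<m}"
        using x by (auto simp: vertices_def delete_vertices_def left right W_def)
      then have "x \<in> Inl ` h ` {..<m} \<or> x \<in> Inr ` p ` {..<m}"
        using h(1) p_img by (simp add: bij_betw_def)
      then obtain r where "r < m" "x = Inl (h r) \<or> x = Inr (p r)" by blast
      then show "\<exists>e\<in>M. x \<in> e" unfolding M_def by blast
    qed
    ultimately have "perfect_matching (delete_vertices ?G S) M"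
      unfolding perfect_matching_def by (intro conjI)
    then show ?thesis ..
  qed
  ultimately have "critical_bipartite k ?G"
    unfolding critical_bipartite_def by simp
  then show ?thesis by (simp add: c_def)
qed

end
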